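(* Let $(L,<)$ be an ordered field and let $w$ be a henselian valuation on $L$ with value group $wL$ and residue field $Lw$. Suppose that at least one of the following holds: (1) $wL$ is discretely ordered; (2) $wL$ has a limit point in $(wL)^{\mathrm{div}}\setminus wL$; (3) $Lw$ has a limit point in $(Lw)^{\mathrm{rc}}\setminus Lw$. Then $w$ is $\mathcal{L}_{\mathrm{or}}$-definable in $L$, i.e. its valuation ring is an $\mathcal{L}_{\mathrm{or}}$-definable subset of $(L,<)$. Moreover, in the cases (1) and (2), $w$ is definable by an $\mathcal{L}_{\mathrm{or}}$-formula with one parameter.
   Context: $\mathcal{L}_{\mathrm{or}}=\{+,-,\cdot,0,1,<\}$ is the language of ordered rings. "Definable" always means definable with parameters. Every henselian valuation $w$ on an ordered field is convex (its valuation ring $\mathcal{O}_w$ is a convex subset), so the residue field $Lw$ carries the induced ordering: $\overline{a}<\overline{b}$ iff $\overline{a}\neq\overline{b}$ and $a<b$. An ordered abelian group $G$ is discretely ordered if $\mathbb{Z}$ is (isomorphic to) a convex subgroup of $G$, i.e. $G$ has a least positive element. $G^{\mathrm{div}}$ denotes the divisible hull of an ordered abelian group $G$ (with the unique extension of the ordering) and $k^{\mathrm{rc}}$ the real closure of an ordered field $k$. Limit points: for an extension $G\subseteq H$ of ordered abelian groups, $g_0\in H$ is a left-sided limit point of $G$ in $H$ if for every $g_1\in H$ with $g_1>0$ the interval $(g_0-g_1,g_0)$ of $H$ meets $G$; it is a right-sided limit point if for every $g_1\in H$ with $g_1>0$ the interval $(g_0,g_0+g_1)$ meets $G$; a limit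 point is a left-sided or right-sided limit point. The same definition (using the additive groups) is used for extensions of ordered fields. In (2) limit points of $wL$ are taken in $(wL)^{\mathrm{div}}$, in (3) limit points of $Lw$ are taken in $(Lw)^{\mathrm{rc}}$. *)

theory Defs
  imports Complex_Main "HOL-Computational_Algebra.Polynomial"
begin

datatype or_term =
    Var nat
  | Zero
  | One
  | Add or_term or_term
  | Minus or_term
  | Mult or_term or_term

datatype or_formula =
    Equal or_term or_term
  | Less or_term or_term
  | Neg or_formula
  | Conj or_formula or_formula
  | Exists nat or_formula

primrec term_value :: "(nat \<Rightarrow> 'a::linordered_field) \<Rightarrow> or_term \<Rightarrow> 'a" where
  "term_value e (Var i) = e i"
| "term_value e Zero = 0"
| "term_value e One = 1"
| "term_value e (Add s t) = term_value e s + term_value e t"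
| "term_value e (Minus t) = - term_value e t"
| "term_value e (Mult s t) = term_value e s * term_value e t"

primrec satisfies :: "(nat \<Rightarrow> 'a::linordered_field) \<Rightarrow> or_formula \<Rightarrow> bool" where
  "satisfies e (Equal s t) \<longleftrightarrow> term_value e s = term_value e t"
| "satisfies e (Less s t) \<longleftrightarrow> term_value e s < term_value e t"
| "satisfies e (Neg \<phi>) \<longleftrightarrow> \<not> satisfies e \<phi>"
| "satisfies e (Conj \<phi> \<psi>) \<longleftrightarrow> satisfies e \<phi> \<and> satisfies e \<psi>"
| "satisfies e (Exists i \<phi>) \<longleftrightarrow> (\<exists>a. satisfies (e(i := a)) \<phi>)"

primrec term_vars :: "or_term \<Rightarrow> nat set" where
  "term_vars (Var i) = {i}"
| "term_vars Zero = {}"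
| "term_vars One = {}"
| "term_vars (Add s t) = term_vars s \<union> term_vars t"
| "term_vars (Minus t) = term_vars t"
| "term_vars (Mult s t) = term_vars s \<union> term_vars t"

primrec free_vars :: "or_formula \<Rightarrow> nat set" where
  "free_vars (Equal s t) = term_vars s \<union> term_vars t"
| "free_vars (Less s t) = term_vars s \<union> term_vars t"
| "free_vars (Neg \<phi>) = free_vars \<phi>"
| "free_vars (Conj \<phi> \<psi>) = free_vars \<phi> \<union> free_vars \<psi>"
| "free_vars (Exists i \<phi>) = free_vars \<phi> - {i}"

text \<open>Variable \<open>0\<close> is the variable of the defined set; the variables \<open>1, \<dots>, n\<close> take the
  parameters \<open>p 1, \<dots>, p n\<close>. The free-variable condition makes the other values of \<open>p\<close>
  irrelevant.\<close>

definition definable_with_params :: "nat \<Rightarrow> 'a::linordered_field set \<Rightarrow> bool" where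
  "definable_with_params n A \<longleftrightarrow>
     (\<exists>\<phi> p. free_vars \<phi> \<subseteq> {0..n} \<and> A = {x. satisfies (p(0 := x)) \<phi>})"

definition definable :: "'a::linordered_field set \<Rightarrow> bool" where
  "definable A \<longleftrightarrow> (\<exists>n. definable_with_params n A)"

text \<open>Valuations are written additively and are surjective, so that the value group is the
  whole type \<open>'g\<close>. The value \<open>w 0\<close>, conventionally \<open>\<infinity>\<close>, is left arbitrary and never used.\<close>

definition valuation :: "('a::field \<Rightarrow> 'g::linordered_ab_group_add) \<Rightarrow> bool" where
  "valuation w \<longleftrightarrow>
     w ` (- {0}) = UNIV \<and>
     (\<forall>x y. x \<noteq> 0 \<longrightarrow> y \<noteq> 0 \<longrightarrow> w (x * y) = w x + w y) \<and>
     (\<forall>x y. x \<noteq> 0 \<longrightarrow> y \<noteq> 0 \<longrightarrow> x + y \<noteq> 0 \<longrightarrow> min (w x) (w y) \<le> w (x + y))"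

definition valuation_ring :: "('a::field \<Rightarrow> 'g::linordered_ab_group_add) \<Rightarrow> 'a set" where
  "valuation_ring w = {x. x = 0 \<or> 0 \<le> w x}"

definition valuation_ideal :: "('a::field \<Rightarrow> 'g::linordered_ab_group_add) \<Rightarrow> 'a set" where
  "valuation_ideal w = {x. x = 0 \<or> 0 < w x}"

definition henselian :: "('a::field \<Rightarrow> 'g::linordered_ab_group_add) \<Rightarrow> bool" where
  "henselian w \<longleftrightarrow>
     valuation w \<and>
     (\<forall>f a. (\<forall>i. coeff f i \<in> valuation_ring w) \<longrightarrow> a \<in> valuation_ring w \<longrightarrow>
        poly f a \<in> valuation_ideal w \<longrightarrow> poly (pderiv f) a \<notin> valuation_ideal w \<longrightarrow>
        (\<exists>b \<in> valuation_ring w. poly f b = 0 \<and> b - a \<in> valuation_ideal w))"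

text \<open>The residue field, with its induced ordering, is represented up to isomorphism: it is the
  type \<open>'k\<close>, the residue map being \<open>res\<close> restricted to the valuation ring.\<close>

definition residue_map ::
  "('a::linordered_field \<Rightarrow> 'g::linordered_ab_group_add) \<Rightarrow> ('a \<Rightarrow> 'k::linordered_field) \<Rightarrow> bool"
where
  "residue_map w res \<longleftrightarrow>
     res ` valuation_ring w = UNIV \<and>
     res 1 = 1 \<and>
     (\<forall>a \<in> valuation_ring w. \<forall>b \<in> valuation_ring w.
        res (a + b) = res a + res b \<and>
        res (a * b) = res a * res b \<and>
        (res a < res b \<longleftrightarrow> res a \<noteq> res b \<and> a < b)) \<and>
     (\<forall>a \<in> valuation_ring w. res a = 0 \<longleftrightarrow> a \<in> valuation_ideal w)"

definition discretely_ordered :: "'g::linordered_ab_group_add itself \<Rightarrow> bool" where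
  "discretely_ordered _ \<longleftrightarrow>
     (\<exists>f :: int \<Rightarrow> 'g.
        (\<forall>m n. f (m + n) = f m + f n) \<and> strict_mono f \<and>
        (\<forall>m n x. f m \<le> x \<longrightarrow> x \<le> f n \<longrightarrow> x \<in> range f))"

text \<open>An extension of ordered abelian groups is given by an embedding \<open>d\<close>; in the next
  definition the sum is the \<open>n\<close>-fold multiple of its constant summand.\<close>

definition divisible_hull ::
  "('g::linordered_ab_group_add \<Rightarrow> 'h::linordered_ab_group_add) \<Rightarrow> bool" where
  "divisible_hull d \<longleftrightarrow>
     (\<forall>x y. d (x + y) = d x + d y) \<and> strict_mono d \<and>
     (\<forall>h::'h. \<forall>n::nat. n > 0 \<longrightarrow> (\<exists>h'. (\<Sum>i<n. h') = h)) \<and>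
     (\<forall>h. \<exists>n::nat. n > 0 \<and> (\<Sum>i<n. h) \<in> range d)"

definition left_limit_point :: "'h::linordered_ab_group_add set \<Rightarrow> 'h \<Rightarrow> bool" where
  "left_limit_point G h \<longleftrightarrow> (\<forall>h1>0. {h - h1<..<h} \<inter> G \<noteq> {})"

definition right_limit_point :: "'h::linordered_ab_group_add set \<Rightarrow> 'h \<Rightarrow> bool" where
  "right_limit_point G h \<longleftrightarrow> (\<forall>h1>0. {h<..<h + h1} \<inter> G \<noteq> {})"

definition limit_point :: "'h::linordered_ab_group_add set \<Rightarrow> 'h \<Rightarrow> bool" where
  "limit_point G h \<longleftrightarrow> left_limit_point G h \<or> right_limit_point G h"

definition real_closed :: "'r::linordered_field itself \<Rightarrow> bool" where
  "real_closed _ \<longleftrightarrow>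
     (\<forall>x::'r. 0 \<le> x \<longrightarrow> (\<exists>y. y\<^sup>2 = x)) \<and>
     (\<forall>p::'r poly. odd (degree p) \<longrightarrow> (\<exists>x. poly p x = 0))"

definition real_closure :: "('k::linordered_field \<Rightarrow> 'r::linordered_field) \<Rightarrow> bool" where
  "real_closure c \<longleftrightarrow>
     c 1 = 1 \<and> (\<forall>x y. c (x + y) = c x + c y) \<and> (\<forall>x y. c (x * y) = c x * c y) \<and>
     strict_mono c \<and>
     real_closed TYPE('r) \<and>
     (\<forall>r. \<exists>p. p \<noteq> 0 \<and> poly (map_poly c p) r = 0)"

end

theory Submission
  imports Defs
begin

text \<open>Hensel's lemma for \<open>X\<^sup>2 + X + x\<close> makes \<open>1 - 4x\<close> a square for every \<open>x\<close> in the valuation ideal, so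
  that \<open>x\<close> stays below \<open>1\<close>. Thus the order and the valuation are tied together: \<open>\<bar>x\<bar> \<le> \<bar>y\<bar>\<close>
  implies \<open>w y \<le> w x\<close> (\<open>henselian_antimono\<close>). Each of the three hypotheses then gives a first-order
  description of the valuation ring.

  If \<open>w t\<close> is the least positive value, then \<open>1 + t x\<^sup>2\<close> is a square for integral \<open>x\<close> by Hensel's
  lemma, while for nonintegral \<open>x\<close> its value \<open>w t + 2 w x\<close> is not divisible by \<open>2\<close>
  (\<open>valuation_ring_iff_square\<close>).

  In the other two cases a limit point outside the group or field is a cut without end points. The
  cut is pulled back to the field \<open>L\<close>, the pullback is shown to be definable, and the valuation
  ring is recovered from the elements that map it into itself: a limit point is too fine a cut to
  be respected by a translation of nonzero size.

  For a limit point \<open>\<gamma>\<close> of the value group, some multiple \<open>n \<gamma>\<close> is a value \<open>w t\<close>. As \<open>w x\<close> never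
  equals \<open>\<gamma>\<close>, the condition \<open>w x > \<gamma>\<close> is \<open>x\<^bsup>2n\<^esup> < t\<^sup>2\<close>, and the integral elements are those that
  multiply this set into itself (\<open>valuation_ring_iff_stabiliser\<close>). The only parameter is \<open>t\<^sup>2\<close>.

  For a limit point \<open>r\<close> of the residue field, take a polynomial of minimal degree with root \<open>r\<close>. The
  root is simple, so the polynomial changes sign there, and near \<open>r\<close> it vanishes nowhere else. Since
  the residue field has elements arbitrarily close to \<open>r\<close> on both sides
  (\<open>limit_point_two_sided\<close>), two of them enclose \<open>r\<close> in an interval where the sign of the
  polynomial decides on which side of \<open>r\<close> an element lies (\<open>isolating_polynomial\<close>). Lifting the
  polynomial and the two end points to \<open>L\<close> defines the pullback of the cut (\<open>lifted_cut\<close>). A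
  positive \<open>u\<close> translates it into itself exactly if \<open>u\<close> lies in the valuation ideal, and \<open>z\<close> is
  integral unless \<open>1 / z\<^sup>2\<close> lies there (\<open>valuation_ring_iff_shift\<close>).\<close>

section \<open>Valuations on a field\<close>

lemma valuation_mult:
  "valuation w \<Longrightarrow> x \<noteq> 0 \<Longrightarrow> y \<noteq> 0 \<Longrightarrow> w (x * y) = w x + w y"
  by (auto simp: valuation_def)

lemma valuation_add:
  "valuation w \<Longrightarrow> x \<noteq> 0 \<Longrightarrow> y \<noteq> 0 \<Longrightarrow> x + y \<noteq> 0 \<Longrightarrow> min (w x) (w y) \<le> w (x + y)"
  by (auto simp: valuation_def)

lemma valuation_surj:
  assumes "valuation w"
  obtains t where "t \<noteq> 0" "w t = g"
proof -
  have "g \<in> w ` (- {0})" using assms by (simp add: valuation_def)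
  then show ?thesis using that by auto
qed

lemma valuation_one: "valuation w \<Longrightarrow> w 1 = 0"
  using valuation_mult[of w 1 1] by simp

lemma valuation_uminus:
  assumes v: "valuation w"
  shows "w (- x) = w x"
proof (cases "x = 0")
  case False
  have "w (- 1) + w (- 1) = 0"
    using valuation_mult[OF v, of "- 1" "- 1"] valuation_one[OF v] by simp
  then have "w (- 1) = 0" by (simp add: double_zero)
  then show ?thesis using valuation_mult[OF v, of "- 1" x] False by simp
qed simp

lemma valuation_inverse:
  "valuation w \<Longrightarrow> x \<noteq> 0 \<Longrightarrow> w (inverse x) = - w x"
  using valuation_mult[of w x "inverse x"] valuation_one[of w]
  by (simp add: eq_neg_iff_add_eq_0 add.commute)

lemma valuation_power:
  "valuation w \<Longrightarrow> x \<noteq> 0 \<Longrightarrow> w (x ^ n) = (\<Sum>i<n. w x)"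
  by (induction n) (auto simp: valuation_one valuation_mult add.commute)

lemma valuation_one_add:
  assumes v: "valuation w" and x: "x \<noteq> 0" "w x < 0"
  shows "1 + x \<noteq> 0 \<and> w (1 + x) = w x"
proof -
  have ne: "1 + x \<noteq> 0"
  proof
    assume "1 + x = 0"
    then have "x = - 1" by (simp add: eq_neg_iff_add_eq_0 add.commute)
    then show False using x valuation_one[OF v] valuation_uminus[OF v, of 1] by simp
  qed
  have "min (w 1) (w x) \<le> w (1 + x)" using valuation_add[OF v, of 1 x] x ne by simp
  moreover have "min (w (1 + x)) (w (- 1)) \<le> w x"
    using valuation_add[OF v, of "1 + x" "- 1"] x ne by simp
  ultimately show ?thesis
    using ne x valuation_one[OF v] valuation_uminus[OF v, of 1] by (auto simp: min_def split: if_splits)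
qed

lemma valuation_ring_mult:
  "valuation w \<Longrightarrow> x \<in> valuation_ring w \<Longrightarrow> y \<in> valuation_ring w \<Longrightarrow> x * y \<in> valuation_ring w"
  by (cases "x = 0 \<or> y = 0") (auto simp: valuation_ring_def valuation_mult)

lemma valuation_ring_add:
  "valuation w \<Longrightarrow> x \<in> valuation_ring w \<Longrightarrow> y \<in> valuation_ring w \<Longrightarrow> x + y \<in> valuation_ring w"
  using valuation_add[of w x y]
  by (cases "x = 0 \<or> y = 0 \<or> x + y = 0") (auto simp: valuation_ring_def min_def split: if_splits)

lemma valuation_ring_uminus:
  "valuation w \<Longrightarrow> x \<in> valuation_ring w \<Longrightarrow> - x \<in> valuation_ring w"
  by (auto simp: valuation_ring_def valuation_uminus)

lemma zero_one_in_valuation_ring: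
  "0 \<in> valuation_ring w" "valuation w \<Longrightarrow> 1 \<in> valuation_ring w"
  by (auto simp: valuation_ring_def valuation_one)

lemma valuation_ideal_uminus:
  "valuation w \<Longrightarrow> x \<in> valuation_ideal w \<Longrightarrow> - x \<in> valuation_ideal w"
  by (auto simp: valuation_ideal_def valuation_uminus)

lemma valuation_ideal_in_ring: "x \<in> valuation_ideal w \<Longrightarrow> x \<in> valuation_ring w"
  by (auto simp: valuation_ideal_def valuation_ring_def)

section \<open>Henselian valuations on an ordered field are convex\<close>

lemma henselian_imp_valuation: "henselian w \<Longrightarrow> valuation w"
  by (simp add: henselian_def)

text \<open>The quadratic \<open>X\<^sup>2 + m X - u\<close> has the simple root \<open>0\<close> modulo the valuation ideal. The case
  \<open>m = 1\<close> yields convexity; once \<open>2\<close> is known to be a unit, \<open>m = 2\<close> yields square roots.\<close>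

lemma henselian_quadratic_root:
  fixes w :: "'a::linordered_field \<Rightarrow> 'g::linordered_ab_group_add"
  assumes h: "henselian w" and u: "u \<in> valuation_ideal w"
    and m: "m \<in> valuation_ring w" "m \<notin> valuation_ideal w"
  obtains b where "b\<^sup>2 + m * b = u"
proof -
  note v = henselian_imp_valuation[OF h]
  let ?f = "[:- u, m, 1:]"
  have "coeff ?f i \<in> valuation_ring w" for i
    using valuation_ideal_in_ring[OF u] m v
    by (auto simp: coeff_pCons zero_one_in_valuation_ring valuation_ring_uminus split: nat.split)
  moreover have "poly ?f 0 \<in> valuation_ideal w" "poly (pderiv ?f) 0 \<notin> valuation_ideal w"
    using valuation_ideal_uminus[OF v u] m by (simp_all add: pderiv_pCons)
  ultimately obtain b where "poly ?f b = 0"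
    using h zero_one_in_valuation_ring(1)[of w] unfolding henselian_def by blast
  then have "b\<^sup>2 + m * b = u" by (simp add: algebra_simps power2_eq_square)
  then show ?thesis by (rule that)
qed

text \<open>If \<open>b\<^sup>2 + b = - x\<close>, then \<open>1 - 4x = (2b + 1)\<^sup>2\<close> is nonnegative, so in fact \<open>x \<le> 1/4\<close>.\<close>

lemma valuation_ideal_lt_one:
  fixes w :: "'a::linordered_field \<Rightarrow> 'g::linordered_ab_group_add"
  assumes h: "henselian w" and x: "x \<in> valuation_ideal w"
  shows "x < 1"
proof -
  note v = henselian_imp_valuation[OF h]
  have "1 \<notin> valuation_ideal w" by (simp add: valuation_ideal_def valuation_one[OF v])
  then obtain b where b: "b\<^sup>2 + 1 * b = - x"
    using henselian_quadratic_root[OF h valuation_ideal_uminus[OF v x], of 1]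
      zero_one_in_valuation_ring(2)[OF v] by metis
  have "(2 * b + 1)\<^sup>2 = 4 * (b\<^sup>2 + 1 * b) + 1"
    by (simp add: power2_eq_square algebra_simps)
  then have "0 \<le> 4 * (- x) + 1" unfolding b by (metis zero_le_power2)
  then show ?thesis by simp
qed

text \<open>Otherwise \<open>\<bar>y\<bar> / \<bar>x\<bar>\<close> would lie in the valuation ideal and hence be smaller than \<open>1\<close>.\<close>

lemma henselian_antimono:
  fixes w :: "'a::linordered_field \<Rightarrow> 'g::linordered_ab_group_add"
  assumes h: "henselian w" and xy: "x \<noteq> 0" "\<bar>x\<bar> \<le> \<bar>y\<bar>"
  shows "w y \<le> w x"
proof (rule ccontr)
  note v = henselian_imp_valuation[OF h]
  have w_abs: "w \<bar>z\<bar> = w z" for z by (simp add: abs_if valuation_uminus[OF v])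
  assume "\<not> w y \<le> w x"
  then have "\<bar>y\<bar> * inverse \<bar>x\<bar> \<in> valuation_ideal w"
    using xy v by (auto simp: valuation_ideal_def valuation_mult valuation_inverse w_abs)
  then have "\<bar>y\<bar> * inverse \<bar>x\<bar> < 1" using valuation_ideal_lt_one[OF h] by blast
  then show False using xy by (simp add: field_simps)
qed

lemma valuation_ring_convex:
  fixes w :: "'a::linordered_field \<Rightarrow> 'g::linordered_ab_group_add"
  assumes "henselian w" "y \<in> valuation_ring w" "\<bar>x\<bar> \<le> \<bar>y\<bar>"
  shows "x \<in> valuation_ring w"
proof (cases "x = 0")
  case False
  then have "w y \<le> w x" "y \<noteq> 0" using henselian_antimono[OF assms(1) False assms(3)] assms(3) by auto
  then show ?thesis using assms(2) by (auto simp: valuation_ring_def)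
qed (simp add: zero_one_in_valuation_ring)

text \<open>The integer \<open>2\<close> is not in the valuation ideal, being larger than \<open>1\<close>; a root \<open>b\<close> of
  \<open>X\<^sup>2 + 2 X = u\<close> gives \<open>(1 + b)\<^sup>2 = 1 + u\<close>.\<close>

lemma henselian_sqrt_one_add:
  fixes w :: "'a::linordered_field \<Rightarrow> 'g::linordered_ab_group_add"
  assumes h: "henselian w" and u: "u \<in> valuation_ideal w"
  shows "\<exists>y. y\<^sup>2 = 1 + u"
proof -
  note v = henselian_imp_valuation[OF h]
  have "2 \<notin> valuation_ideal w" using valuation_ideal_lt_one[OF h, of 2] by auto
  moreover have "2 \<in> valuation_ring w"
    using valuation_ring_add[OF v, of 1 1] zero_one_in_valuation_ring(2)[OF v] by simp
  ultimately obtain b where "b\<^sup>2 + 2 * b = u" using henselian_quadratic_root[OF h u] by metis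
  then have "(1 + b)\<^sup>2 = 1 + u" by (simp add: power2_eq_square algebra_simps)
  then show ?thesis ..
qed

section \<open>Discretely ordered value group\<close>

lemma discretely_ordered_least_positive:
  assumes "discretely_ordered TYPE('g::linordered_ab_group_add)"
  obtains e :: "'g::linordered_ab_group_add" where "0 < e" "\<And>x. 0 < x \<Longrightarrow> e \<le> x"
proof -
  obtain f :: "int \<Rightarrow> 'g" where f: "\<And>m n. f (m + n) = f m + f n" "strict_mono f"
      "\<And>m n x. f m \<le> x \<Longrightarrow> x \<le> f n \<Longrightarrow> x \<in> range f"
    using assms unfolding discretely_ordered_def by blast
  have f0: "f 0 = 0" using f(1)[of 0 0] by simp
  have "0 < f 1" using strict_monoD[OF f(2), of 0 1] f0 by simp
  moreover have "f 1 \<le> x" if "0 < x" for x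
  proof (rule ccontr)
    assume "\<not> f 1 \<le> x"
    then obtain k where "x = f k" using f(3)[of 0 x 1] f0 \<open>0 < x\<close> by force
    then have "f 0 < f k" "f k < f 1" using \<open>0 < x\<close> \<open>\<not> f 1 \<le> x\<close> f0 by auto
    then show False using strict_mono_less[OF f(2)] by force
  qed
  ultimately show ?thesis by (rule that)
qed

text \<open>For \<open>w x < 0\<close> minimality gives \<open>w t \<le> - w x\<close>, so \<open>t x\<^sup>2\<close> still has negative value and dominates
  the summand \<open>1\<close>. A square root \<open>y\<close> would then exhibit the least positive value as
  \<open>2 (w y - w x)\<close>, twice a smaller positive one.\<close>

lemma valuation_ring_iff_square:
  fixes w :: "'a::linordered_field \<Rightarrow> 'g::linordered_ab_group_add"
  assumes h: "henselian w" and t: "t \<noteq> 0" "0 < w t" and min: "\<And>g. 0 < g \<Longrightarrow> w t \<le> g"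
  shows "x \<in> valuation_ring w \<longleftrightarrow> (\<exists>y. y * y = 1 + t * (x * x))"
proof
  note v = henselian_imp_valuation[OF h]
  assume "x \<in> valuation_ring w"
  then have "t * (x * x) \<in> valuation_ideal w"
    using t v by (cases "x = 0")
      (auto simp: valuation_ring_def valuation_ideal_def valuation_mult add_pos_nonneg)
  then show "\<exists>y. y * y = 1 + t * (x * x)"
    using henselian_sqrt_one_add[OF h] by (simp add: power2_eq_square)
next
  note v = henselian_imp_valuation[OF h]
  assume "\<exists>y. y * y = 1 + t * (x * x)"
  then obtain y where y: "y * y = 1 + t * (x * x)" ..
  show "x \<in> valuation_ring w"
  proof (rule ccontr)
    assume "x \<notin> valuation_ring w"
    then have x: "x \<noteq> 0" "w x < 0" by (auto simp: valuation_ring_def)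
    have "w t \<le> - w x" using min[of "- w x"] x by simp
    then have "w t + w x \<le> 0" using add_right_mono[of "w t" "- w x" "w x"] by simp
    then have "w (t * (x * x)) < 0"
      using x t v add_le_less_mono[of "w t + w x" 0 "w x" 0]
      by (simp add: valuation_mult add.assoc)
    then have "1 + t * (x * x) \<noteq> 0" "w (1 + t * (x * x)) = w (t * (x * x))"
      using valuation_one_add[OF v, of "t * (x * x)"] x t by auto
    moreover have "y \<noteq> 0" using y \<open>1 + t * (x * x) \<noteq> 0\<close> by force
    ultimately have "w y + w y = w t + (w x + w x)"
      using x t v valuation_mult[OF v, of y y] by (simp add: y valuation_mult)
    then have half: "w t = (w y - w x) + (w y - w x)" by (simp add: algebra_simps)
    then have "0 < w y - w x" using t(2) by (metis add_nonpos_nonpos not_less)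
    then show False using min[of "w y - w x"] half by simp
  qed
qed

lemma definable_discrete:
  fixes w :: "'a::linordered_field \<Rightarrow> 'g::linordered_ab_group_add"
  assumes h: "henselian w" and discrete: "discretely_ordered TYPE('g)"
  shows "definable_with_params 1 (valuation_ring w)"
proof -
  obtain e :: 'g where e: "0 < e" "\<And>x. 0 < x \<Longrightarrow> e \<le> x"
    using discretely_ordered_least_positive[OF discrete] by blast
  obtain t where t: "t \<noteq> 0" "w t = e"
    using valuation_surj[OF henselian_imp_valuation[OF h]] .
  let ?\<phi> = "Exists 2 (Equal (Mult (Var 2) (Var 2))
    (Add One (Mult (Var 1) (Mult (Var 0) (Var 0)))))"
  have "valuation_ring w = {x. satisfies ((\<lambda>_. t)(0 := x)) ?\<phi>}"
    using valuation_ring_iff_square[OF h, of t] t e by auto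
  moreover have "free_vars ?\<phi> \<subseteq> {0..1}" by auto
  ultimately show ?thesis unfolding definable_with_params_def by blast
qed

section \<open>A limit point of the value group in its divisible hull\<close>

lemma additive_sum:
  fixes d :: "'g::linordered_ab_group_add \<Rightarrow> 'h::linordered_ab_group_add"
  assumes "\<And>x y. d (x + y) = d x + d y"
  shows "d (\<Sum>i<n. g) = (\<Sum>i<(n::nat). d g)"
proof -
  have "d 0 = 0" using assms[of 0 0] by simp
  then show ?thesis by (induction n) (simp_all add: assms)
qed

lemma const_sum_strict_mono:
  fixes g g' :: "'h::linordered_ab_group_add"
  shows "0 < n \<Longrightarrow> g < g' \<Longrightarrow> (\<Sum>i<(n::nat). g) < (\<Sum>i<n. g')"
  by (rule sum_strict_mono) auto

text \<open>Comparing \<open>x\<^sup>n\<close> with \<open>t\<close> in absolute value compares their values \<open>n w x\<close> and \<open>n \<gamma>\<close>, which are never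
  equal. Squaring both sides expresses the absolute values by ring terms.\<close>

lemma power_less_iff_cut:
  fixes w :: "'a::linordered_field \<Rightarrow> 'g::linordered_ab_group_add"
    and d :: "'g \<Rightarrow> 'h::linordered_ab_group_add"
  assumes h: "henselian w" and d: "\<And>x y. d (x + y) = d x + d y" "strict_mono d"
    and n: "0 < n" and t: "t \<noteq> 0" "d (w t) = (\<Sum>i<n. \<gamma>)" and \<gamma>: "\<gamma> \<notin> range d"
    and x: "x \<noteq> 0"
  shows "x ^ (2 * n) < t\<^sup>2 \<longleftrightarrow> \<gamma> < d (w x)"
proof -
  note v = henselian_imp_valuation[OF h]
  have value_x: "d (w (x ^ n)) = (\<Sum>i<n. d (w x))"
    by (simp add: valuation_power[OF v x] additive_sum[of d, OF d(1)])
  have power: "x ^ (2 * n) = (x ^ n)\<^sup>2" by (simp add: power_mult[symmetric] mult.commute)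
  show ?thesis
  proof
    assume less: "\<gamma> < d (w x)"
    show "x ^ (2 * n) < t\<^sup>2"
    proof (rule ccontr)
      assume "\<not> x ^ (2 * n) < t\<^sup>2"
      then have "\<bar>t\<bar> \<le> \<bar>x ^ n\<bar>" by (simp add: power abs_le_square_iff)
      then have "d (w (x ^ n)) \<le> d (w t)"
        using henselian_antimono[OF h t(1)] by (simp add: strict_mono_less_eq[OF d(2)])
      then show False using const_sum_strict_mono[OF n less] value_x t(2) by simp
    qed
  next
    assume "x ^ (2 * n) < t\<^sup>2"
    then have "\<bar>x ^ n\<bar> \<le> \<bar>t\<bar>" by (simp add: power abs_le_square_iff)
    then have "d (w t) \<le> d (w (x ^ n))"
      using henselian_antimono[OF h, of "x ^ n"] x by (simp add: strict_mono_less_eq[OF d(2)])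
    then have "\<not> d (w x) < \<gamma>"
      using const_sum_strict_mono[OF n, of "d (w x)" \<gamma>] value_x t(2) by force
    moreover have "d (w x) \<noteq> \<gamma>" using \<gamma> by auto
    ultimately show "\<gamma> < d (w x)" by simp
  qed
qed

lemma limit_point_meets_interval:
  fixes \<gamma> :: "'h::linordered_ab_group_add"
  assumes "limit_point G \<gamma>" "0 < e"
  shows "(\<exists>g\<in>G. \<gamma> - e < g \<and> g < \<gamma>) \<or> (\<exists>g\<in>G. \<gamma> < g \<and> g < \<gamma> + e)"
  using assms unfolding limit_point_def left_limit_point_def right_limit_point_def by fastforce

text \<open>If \<open>w y < 0\<close>, some value lies within \<open>- w y\<close> of \<open>\<gamma>\<close>. If it lies above \<open>\<gamma>\<close>, adding \<open>w y\<close> moves it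
  below \<open>\<gamma>\<close>; if it lies below, it is itself the sum of \<open>w y\<close> and a value above \<open>\<gamma>\<close>. So the same
  description serves both kinds of limit points.\<close>

lemma valuation_ring_iff_stabiliser:
  fixes w :: "'a::linordered_field \<Rightarrow> 'g::linordered_ab_group_add"
    and d :: "'g \<Rightarrow> 'h::linordered_ab_group_add"
  assumes h: "henselian w" and d: "\<And>x y. d (x + y) = d x + d y" "strict_mono d"
    and n: "0 < n" and t: "t \<noteq> 0" "d (w t) = (\<Sum>i<n. \<gamma>)" and \<gamma>: "\<gamma> \<notin> range d"
    and lim: "limit_point (range d) \<gamma>"
  shows "y \<in> valuation_ring w \<longleftrightarrow> (\<forall>x. x ^ (2 * n) < t\<^sup>2 \<longrightarrow> (x * y) ^ (2 * n) < t\<^sup>2)"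
proof
  note v = henselian_imp_valuation[OF h]
  note cut = power_less_iff_cut[OF h d n t \<gamma>]
  assume y: "y \<in> valuation_ring w"
  show "\<forall>x. x ^ (2 * n) < t\<^sup>2 \<longrightarrow> (x * y) ^ (2 * n) < t\<^sup>2"
  proof (intro allI impI)
    fix x assume x: "x ^ (2 * n) < t\<^sup>2"
    show "(x * y) ^ (2 * n) < t\<^sup>2"
    proof (cases "x * y = 0")
      case True
      then show ?thesis using n t by (auto simp: power_0_left)
    next
      case False
      then have "w x \<le> w (x * y)" using y v by (auto simp: valuation_mult valuation_ring_def)
      then have "d (w x) \<le> d (w (x * y))" by (simp add: d(2) strict_mono_less_eq)
      then show ?thesis using cut[of x] cut[of "x * y"] x False by auto
    qed
  qed
next
  note v = henselian_imp_valuation[OF h]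
  note cut = power_less_iff_cut[OF h d n t \<gamma>]
  assume stab: "\<forall>x. x ^ (2 * n) < t\<^sup>2 \<longrightarrow> (x * y) ^ (2 * n) < t\<^sup>2"
  show "y \<in> valuation_ring w"
  proof (rule ccontr)
    assume "y \<notin> valuation_ring w"
    then have y: "y \<noteq> 0" "w y < 0" by (auto simp: valuation_ring_def)
    have d0: "d 0 = 0" using d(1)[of 0 0] by simp
    have dy: "d (w y) < 0" using strict_monoD[OF d(2) y(2)] d0 by simp
    have d_diff: "d (a - b) = d a - d b" for a b using d(1)[of "a - b" b] by (simp add: algebra_simps)
    obtain g0 where "\<gamma> + d (w y) < d g0 \<and> d g0 < \<gamma> \<or> \<gamma> < d g0 \<and> d g0 < \<gamma> - d (w y)"
      using limit_point_meets_interval[OF lim, of "- d (w y)"] dy by auto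
    then have "\<exists>g. \<gamma> < d g \<and> d (g + w y) < \<gamma>"
    proof
      assume "\<gamma> + d (w y) < d g0 \<and> d g0 < \<gamma>"
      then show ?thesis by (intro exI[of _ "g0 - w y"]) (simp add: d_diff less_diff_eq)
    next
      assume "\<gamma> < d g0 \<and> d g0 < \<gamma> - d (w y)"
      then show ?thesis by (intro exI[of _ g0]) (simp add: d(1) less_diff_eq)
    qed
    then obtain g where g: "\<gamma> < d g" "d (g + w y) < \<gamma>" by blast
    obtain x where x: "x \<noteq> 0" "w x = g" using valuation_surj[OF v] .
    show False
      using stab cut[of x] cut[of "x * y"] x y g v by (auto simp: valuation_mult)
  qed
qed

primrec Power :: "or_term \<Rightarrow> nat \<Rightarrow> or_term" where
  "Power s 0 = One"
| "Power s (Suc n) = Mult s (Power s n)"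

lemma term_value_Power [simp]: "term_value e (Power s n) = term_value e s ^ n"
  by (induction n) auto

lemma term_vars_Power: "term_vars (Power s n) \<subseteq> term_vars s"
  by (induction n) auto

lemma definable_value_group_limit_point:
  fixes w :: "'a::linordered_field \<Rightarrow> 'g::linordered_ab_group_add"
    and d :: "'g \<Rightarrow> 'h::linordered_ab_group_add"
  assumes h: "henselian w" and hull: "divisible_hull d"
    and lim: "limit_point (range d) \<gamma>" and \<gamma>: "\<gamma> \<notin> range d"
  shows "definable_with_params 1 (valuation_ring w)"
proof -
  have d: "\<And>x y. d (x + y) = d x + d y" "strict_mono d"
    using hull by (auto simp: divisible_hull_def)
  obtain n :: nat and g where n: "0 < n" and g: "d g = (\<Sum>i<n. \<gamma>)"
    using hull unfolding divisible_hull_def by (metis rangeE)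
  obtain t where t: "t \<noteq> 0" "w t = g" using valuation_surj[OF henselian_imp_valuation[OF h]] .
  let ?\<phi> = "Neg (Exists 2 (Conj (Less (Power (Var 2) (2 * n)) (Var 1))
    (Neg (Less (Power (Mult (Var 2) (Var 0)) (2 * n)) (Var 1)))))"
  have "valuation_ring w = {x. satisfies ((\<lambda>_. t\<^sup>2)(0 := x)) ?\<phi>}"
    using valuation_ring_iff_stabiliser[OF h d n t(1) _ \<gamma> lim] t g by auto
  moreover have "free_vars ?\<phi> \<subseteq> {0..1}"
    using term_vars_Power[of "Var 2" "2 * n"] term_vars_Power[of "Mult (Var 2) (Var 0)" "2 * n"]
    by auto
  ultimately show ?thesis unfolding definable_with_params_def by blast
qed

section \<open>Isolating an algebraic element by a sign change\<close>

text \<open>Intervals of a general ordered field are not compact; the bound is built from the coefficients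
  instead.\<close>

lemma poly_bounded:
  fixes p :: "'r::linordered_field poly"
  shows "\<exists>M. \<forall>x. \<bar>x\<bar> \<le> K \<longrightarrow> \<bar>poly p x\<bar> \<le> M"
proof (induction p)
  case (pCons a p)
  then obtain M where M: "\<bar>poly p x\<bar> \<le> M" if "\<bar>x\<bar> \<le> K" for x by blast
  have "\<bar>poly (pCons a p) x\<bar> \<le> \<bar>a\<bar> + K * M" if "\<bar>x\<bar> \<le> K" for x
  proof -
    have "\<bar>x * poly p x\<bar> \<le> K * M"
      unfolding abs_mult using that M[OF that] by (intro mult_mono) auto
    then show ?thesis using abs_triangle_ineq[of a "x * poly p x"] by simp
  qed
  then show ?case by blast
qed auto

text \<open>Continuity of polynomials in the order topology: \<open>p x - p r\<close> is \<open>x - r\<close> times a polynomial that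
  is bounded by some \<open>M\<close> near \<open>r\<close>.\<close>

lemma poly_pos_near:
  fixes p :: "'r::linordered_field poly"
  assumes "0 < poly p r"
  shows "\<exists>e>0. \<forall>x. \<bar>x - r\<bar> < e \<longrightarrow> 0 < poly p x"
proof -
  have "poly (p - [:poly p r:]) r = 0" by simp
  then obtain q where q0: "p - [:poly p r:] = [:- r, 1:] * q" by (metis poly_eq_0_iff_dvd dvdE)
  have q: "poly p x = poly p r + (x - r) * poly q x" for x
  proof -
    have "poly (p - [:poly p r:]) x = (x - r) * poly q x" unfolding q0 by (simp add: algebra_simps)
    then show ?thesis by (simp add: algebra_simps)
  qed
  obtain M where M: "\<bar>poly q x\<bar> \<le> M" if "\<bar>x\<bar> \<le> \<bar>r\<bar> + 1" for x
    using poly_bounded[of "\<bar>r\<bar> + 1" q] by blast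
  have M0: "0 \<le> M" using M[of r] by simp
  \<comment> \<open>The bound \<open>1\<close> keeps \<open>x\<close> where \<open>M\<close> applies; \<open>M + 1\<close> avoids division by zero.\<close>
  define e where "e = min 1 (poly p r / (M + 1))"
  have "0 < e" using assms M0 by (simp add: e_def)
  moreover have "0 < poly p x" if x: "\<bar>x - r\<bar> < e" for x
  proof -
    have "\<bar>x\<bar> \<le> \<bar>r\<bar> + 1" using x by (auto simp: e_def)
    have "\<bar>(x - r) * poly q x\<bar> \<le> \<bar>x - r\<bar> * M"
      unfolding abs_mult by (intro mult_left_mono M \<open>\<bar>x\<bar> \<le> \<bar>r\<bar> + 1\<close>) simp
    also have "\<dots> \<le> e * M" using x M0 by (intro mult_right_mono) auto
    also have "\<dots> \<le> poly p r / (M + 1) * M" using M0 by (intro mult_right_mono) (auto simp: e_def)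
    also have "\<dots> < poly p r" using M0 assms by (simp add: field_simps)
    finally show ?thesis using q[of x] by (auto simp: abs_if split: if_splits)
  qed
  ultimately show ?thesis by blast
qed

text \<open>Dividing out \<open>x - r\<close> leaves a cofactor whose value at \<open>r\<close> is \<open>p' r\<close>. By
  continuity the cofactor stays positive near \<open>r\<close>.\<close>

lemma simple_root_sign_change:
  fixes p :: "'r::linordered_field poly"
  assumes root: "poly p r = 0" and deriv: "0 < poly (pderiv p) r"
  shows "\<exists>e>0. \<forall>x. \<bar>x - r\<bar> < e \<longrightarrow> sgn (poly p x) = sgn (x - r)"
proof -
  obtain q where q: "p = [:- r, 1:] * q" using root by (metis poly_eq_0_iff_dvd dvdE)
  have "poly (pderiv p) r = poly q r" unfolding q pderiv_mult by (simp add: pderiv_pCons)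
  then obtain e where e: "0 < e" "\<And>x. \<bar>x - r\<bar> < e \<Longrightarrow> 0 < poly q x"
    using poly_pos_near[of q r] deriv by auto
  have "sgn (poly p x) = sgn (x - r)" if "\<bar>x - r\<bar> < e" for x
  proof -
    have "poly p x = (x - r) * poly q x" by (simp add: q algebra_simps)
    then show ?thesis using e(2)[OF that] by (simp add: sgn_mult)
  qed
  then show ?thesis using e(1) by blast
qed

text \<open>Given \<open>x < r\<close> in the smaller group, pick a second element \<open>x'\<close> of it that is more than twice as
  close to \<open>r\<close>; reflecting \<open>x\<close> at \<open>x'\<close> lands beyond \<open>r\<close>, at a distance less than \<open>r - x\<close>.\<close>

lemma limit_point_two_sided:
  fixes c :: "'k::linordered_field \<Rightarrow> 'r::linordered_field"
  assumes c: "\<And>x y. c (x + y) = c x + c y" and lim: "limit_point (range c) r" and e: "0 < e"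
  shows "\<exists>x. r - e < c x \<and> c x < r" "\<exists>x. r < c x \<and> c x < r + e"
proof -
  have c_diff: "c (x - y) = c x - c y" for x y using c[of "x - y" y] by simp
  have "(\<exists>x. r - e < c x \<and> c x < r) \<and> (\<exists>x. r < c x \<and> c x < r + e)"
    using lim unfolding limit_point_def
  proof
    assume "left_limit_point (range c) r"
    then have L: "\<exists>x. r - e < c x \<and> c x < r" if "0 < e" for e
      using that unfolding left_limit_point_def by fastforce
    obtain x where x: "r - e < c x" "c x < r" using L[OF e] by blast
    obtain x' where x': "r - (r - c x) / 2 < c x'" "c x' < r" using L[of "(r - c x) / 2"] x by auto
    have "r < c (x' + x' - x)" "c (x' + x' - x) < r + e"
      using x x' unfolding c_diff c by (auto simp: field_simps)
    then show ?thesis using x by blast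
  next
    assume "right_limit_point (range c) r"
    then have R: "\<exists>x. r < c x \<and> c x < r + e" if "0 < e" for e
      using that unfolding right_limit_point_def by fastforce
    obtain x where x: "r < c x" "c x < r + e" using R[OF e] by blast
    obtain x' where x': "r < c x'" "c x' < r + (c x - r) / 2" using R[of "(c x - r) / 2"] x by auto
    have "c (x' + x' - x) < r" "r - e < c (x' + x' - x)"
      using x x' unfolding c_diff c by (auto simp: field_simps)
    then show ?thesis using x by blast
  qed
  then show "\<exists>x. r - e < c x \<and> c x < r" "\<exists>x. r < c x \<and> c x < r + e" by auto
qed

text \<open>Minimality of the degree and characteristic zero make \<open>r\<close> a simple root. The end points are
  chosen inside the neighbourhood of \<open>r\<close> in which the sign of the polynomial is that of \<open>x - r\<close>.\<close>

lemma isolating_polynomial: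
  fixes c :: "'k::linordered_field \<Rightarrow> 'r::linordered_field"
  assumes c: "c 1 = 1" "\<And>x y. c (x + y) = c x + c y" "\<And>x y. c (x * y) = c x * c y" "strict_mono c"
    and alg: "\<exists>p. p \<noteq> 0 \<and> poly (map_poly c p) r = 0"
    and lim: "limit_point (range c) r" and r: "r \<notin> range c"
  obtains p a b where "c a < r" "r < c b"
    "\<And>x. a \<le> x \<Longrightarrow> x \<le> b \<Longrightarrow> poly p x \<noteq> 0 \<and> (poly p x < 0 \<longleftrightarrow> c x < r)"
proof -
  have c0: "c 0 = 0" using c(2)[of 0 0] by simp
  have c_eq: "c x = c y \<longleftrightarrow> x = y" for x y using c(4) by (simp add: strict_mono_eq)
  have c_minus: "c (- x) = - c x" for x
    using c(2)[of "- x" x] c0 by (simp add: eq_neg_iff_add_eq_0)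
  have c_nat: "c (of_nat n) = of_nat n" for n by (induction n) (simp_all add: c0 c)
  have poly_c: "poly (map_poly c p) (c x) = c (poly p x)" for p x
    by (induction p) (simp_all add: map_poly_pCons c0 c)
  have pderiv_c: "map_poly c (pderiv p) = pderiv (map_poly c p)" for p
    by (rule poly_eqI) (simp add: coeff_map_poly c0 coeff_pderiv c c_nat del: of_nat_Suc)
  let ?P = "\<lambda>p. p \<noteq> 0 \<and> poly (map_poly c p) r = 0"
  obtain p0 where p0: "?P p0" "\<And>q. ?P q \<Longrightarrow> degree p0 \<le> degree q"
    using ex_has_least_nat[of ?P _ degree] alg by metis
  have "degree p0 \<noteq> 0"
  proof
    assume "degree p0 = 0"
    then obtain k where "p0 = [:k:]" by (metis degree_eq_zeroE)
    then show False using p0(1) c_eq[of k 0] c0 by (simp add: map_poly_pCons)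
  qed
  then have "pderiv p0 \<noteq> 0" "degree (pderiv p0) < degree p0"
    by (auto simp: pderiv_eq_0_iff degree_pderiv)
  then have deriv0: "poly (pderiv (map_poly c p0)) r \<noteq> 0"
    using p0(2)[of "pderiv p0"] by (auto simp: pderiv_c)
  \<comment> \<open>Passing to \<open>- p0\<close> if necessary makes the sign change go from negative to positive.\<close>
  obtain p where p: "poly (map_poly c p) r = 0" "0 < poly (pderiv (map_poly c p)) r"
  proof (cases "0 < poly (pderiv (map_poly c p0)) r")
    case False
    have "map_poly c (- p0) = - map_poly c p0"
      by (rule poly_eqI) (simp add: coeff_map_poly c0 c_minus)
    then show ?thesis using that[of "- p0"] p0(1) deriv0 False by (auto simp: pderiv_minus)
  qed (use that p0(1) in blast)
  obtain e where e: "0 < e"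
    "\<And>x. \<bar>x - r\<bar> < e \<Longrightarrow> sgn (poly (map_poly c p) x) = sgn (x - r)"
    using simple_root_sign_change[OF p] by blast
  obtain a where a: "r - e < c a" "c a < r" using limit_point_two_sided(1)[OF c(2) lim e(1)] by blast
  obtain b where b: "r < c b" "c b < r + e" using limit_point_two_sided(2)[OF c(2) lim e(1)] by blast
  have "poly p x \<noteq> 0 \<and> (poly p x < 0 \<longleftrightarrow> c x < r)" if "a \<le> x" "x \<le> b" for x
  proof -
    have "c a \<le> c x" "c x \<le> c b" using that c(4) by (simp_all add: strict_mono_less_eq)
    then have "\<bar>c x - r\<bar> < e" using a b by (simp add: abs_less_iff)
    then have *: "sgn (c (poly p x)) = sgn (c x - r)" using e(2)[of "c x"] by (simp add: poly_c)
    have "c (poly p x) < 0 \<longleftrightarrow> poly p x < 0" using strict_mono_less[OF c(4), of _ 0] c0 by simp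
    moreover have "c x \<noteq> r" using r by auto
    ultimately show ?thesis using * c0
      by (auto simp: sgn_if split: if_splits)
  qed
  then show ?thesis using that a(2) b(1) by blast
qed

section \<open>A limit point of the residue field in its real closure\<close>

lemma residue_map_zero: "residue_map w res \<Longrightarrow> res 0 = 0"
  by (auto simp: residue_map_def valuation_ring_def valuation_ideal_def)

lemma residue_map_add:
  "residue_map w res \<Longrightarrow> x \<in> valuation_ring w \<Longrightarrow> y \<in> valuation_ring w \<Longrightarrow>
    res (x + y) = res x + res y"
  by (simp add: residue_map_def)

lemma residue_map_less:
  "residue_map w res \<Longrightarrow> x \<in> valuation_ring w \<Longrightarrow> y \<in> valuation_ring w \<Longrightarrow>
    res x < res y \<longleftrightarrow> res x \<noteq> res y \<and> x < y"
  by (simp add: residue_map_def)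

lemma residue_map_mono:
  "residue_map w res \<Longrightarrow> x \<in> valuation_ring w \<Longrightarrow> y \<in> valuation_ring w \<Longrightarrow> x \<le> y \<Longrightarrow>
    res x \<le> res y"
  using residue_map_less[of w res y x] by auto

lemma residue_map_lift:
  assumes "residue_map w res"
  obtains x where "x \<in> valuation_ring w" "res x = k"
proof -
  have "k \<in> res ` valuation_ring w" using assms by (simp add: residue_map_def)
  then show ?thesis using that by auto
qed

lemma residue_map_lift_poly:
  fixes res :: "'a::linordered_field \<Rightarrow> 'k::linordered_field"
  assumes v: "valuation w" and res: "residue_map w res"
  shows "\<exists>f. \<forall>x\<in>valuation_ring w. poly f x \<in> valuation_ring w \<and> res (poly f x) = poly p (res x)"
proof (induction p)
  case 0
  then show ?case
    by (intro exI[of _ 0]) (simp add: zero_one_in_valuation_ring residue_map_zero[OF res])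
next
  case (pCons k p)
  then obtain f where f: "\<And>x. x \<in> valuation_ring w \<Longrightarrow>
    poly f x \<in> valuation_ring w \<and> res (poly f x) = poly p (res x)" by blast
  obtain a where a: "a \<in> valuation_ring w" "res a = k" using residue_map_lift[OF res] .
  have "poly (pCons a f) x \<in> valuation_ring w \<and>
      res (poly (pCons a f) x) = poly (pCons k p) (res x)" if x: "x \<in> valuation_ring w" for x
  proof -
    have *: "x * poly f x \<in> valuation_ring w" using f[OF x] x v by (simp add: valuation_ring_mult)
    moreover have "res (x * poly f x) = res x * res (poly f x)"
      using res f[OF x] x by (simp add: residue_map_def)
    ultimately show ?thesis using a f[OF x] v residue_map_add[OF res a(1) *]
      by (simp add: valuation_ring_add)
  qed
  then show ?case by blast
qed

text \<open>The pullback of the cut at \<open>r\<close> contains all negative and no positive elements outside the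
  valuation ring. Inside the ring, membership is decided by \<open>A\<close> and \<open>B\<close> outside the interval they
  bound and by the sign of \<open>f\<close> within it; there the residue of \<open>f x\<close> is not zero, so its sign in
  the residue field is the sign of \<open>f x\<close>.\<close>

lemma lifted_cut:
  fixes w :: "'a::linordered_field \<Rightarrow> 'g::linordered_ab_group_add"
    and res :: "'a \<Rightarrow> 'k::linordered_field" and c :: "'k \<Rightarrow> 'r::linordered_field"
  assumes h: "henselian w" and res: "residue_map w res" and c: "real_closure c"
    and lim: "limit_point (range c) r" and r: "r \<notin> range c"
  obtains f A B where
    "\<forall>x. (x < A \<or> x \<le> B \<and> poly f x < 0) \<longleftrightarrow>
      (if x \<in> valuation_ring w then c (res x) < r else x < 0)"
proof -
  let ?O = "valuation_ring w"
  note v = henselian_imp_valuation[OF h]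
  have c_mono: "strict_mono c" using c by (simp add: real_closure_def)
  obtain p a b where ab: "c a < r" "r < c b" and
    p: "\<And>x. a \<le> x \<Longrightarrow> x \<le> b \<Longrightarrow> poly p x \<noteq> 0 \<and> (poly p x < 0 \<longleftrightarrow> c x < r)"
    by (rule isolating_polynomial[of c r]) (use c lim r in \<open>auto simp: real_closure_def\<close>)
  obtain A where A: "A \<in> ?O" "res A = a" using residue_map_lift[OF res] .
  obtain B where B: "B \<in> ?O" "res B = b" using residue_map_lift[OF res] .
  obtain f where f: "\<And>x. x \<in> ?O \<Longrightarrow> poly f x \<in> ?O \<and> res (poly f x) = poly p (res x)"
    using residue_map_lift_poly[OF v res, of p] by blast
  have "x < A \<or> x \<le> B \<and> poly f x < 0 \<longleftrightarrow> c (res x) < r" if x: "x \<in> ?O" for x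
  proof -
    consider "x < A" | "B < x" "A \<le> x" | "A \<le> x" "x \<le> B" by fastforce
    then show ?thesis
    proof cases
      case 1
      then have "res x \<le> a" using residue_map_mono[OF res x A(1)] A(2) by simp
      then have "c (res x) \<le> c a" by (simp add: strict_mono_less_eq[OF c_mono])
      then show ?thesis using 1 ab by auto
    next
      case 2
      then have "b \<le> res x" using residue_map_mono[OF res B(1) x] B(2) by simp
      then have "c b \<le> c (res x)" by (simp add: strict_mono_less_eq[OF c_mono])
      then show ?thesis using 2 ab by auto
    next
      case 3
      then have "a \<le> res x" "res x \<le> b"
        using residue_map_mono[OF res A(1) x] residue_map_mono[OF res x B(1)] A(2) B(2) by auto
      then have "poly p (res x) \<noteq> 0" "poly p (res x) < 0 \<longleftrightarrow> c (res x) < r" using p by auto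
      then show ?thesis
        using 3 f[OF x] residue_map_less[OF res _ zero_one_in_valuation_ring(1), of "poly f x"]
        by (auto simp: residue_map_zero[OF res])
    qed
  qed
  moreover have "x < A \<or> x \<le> B \<and> poly f x < 0 \<longleftrightarrow> x < 0" if x: "x \<notin> ?O" for x
  proof -
    have "\<bar>A\<bar> < \<bar>x\<bar>" "\<bar>B\<bar> < \<bar>x\<bar>" using valuation_ring_convex[OF h] A B x by (meson not_less)+
    then show ?thesis by (auto simp: abs_if split: if_splits)
  qed
  ultimately show ?thesis using that[of A B f] by presburger
qed

text \<open>Here \<open>u\<close> is \<open>1 / z\<^sup>2\<close>, which is automatically positive: for negative \<open>u\<close> the shift would always stay
  in the lower set \<open>S\<close>. If \<open>u\<close> is infinitesimal, it changes neither residues nor the sign of an element outside the valuation ring; if not, either its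
  residue is positive and some residue within that distance of \<open>r\<close> is moved past \<open>r\<close>, or \<open>u\<close> exceeds
  the whole valuation ring.\<close>

lemma valuation_ring_iff_shift:
  fixes w :: "'a::linordered_field \<Rightarrow> 'g::linordered_ab_group_add"
    and res :: "'a \<Rightarrow> 'k::linordered_field" and c :: "'k \<Rightarrow> 'r::linordered_field"
  assumes h: "henselian w" and res: "residue_map w res"
    and c: "\<And>x y. c (x + y) = c x + c y" "strict_mono c"
    and lim: "limit_point (range c) r"
    and S_in: "\<And>x. x \<in> valuation_ring w \<Longrightarrow> x \<in> S \<longleftrightarrow> c (res x) < r"
    and S_out: "\<And>x. x \<notin> valuation_ring w \<Longrightarrow> x \<in> S \<longleftrightarrow> x < 0"
  shows "z \<in> valuation_ring w \<longleftrightarrow> (\<forall>u. u * (z * z) = 1 \<longrightarrow> (\<exists>x\<in>S. x + u \<notin> S))"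
proof -
  let ?O = "valuation_ring w"
  note v = henselian_imp_valuation[OF h]
  have c0: "c 0 = 0" using c(1)[of 0 0] by simp
  have sq: "u \<in> valuation_ideal w \<longleftrightarrow> z \<notin> ?O" and pos: "0 < u" if "u * (z * z) = 1" for u z
  proof -
    have z: "z \<noteq> 0" and u: "u = inverse z * inverse z"
      using that inverse_unique[of "z * z" u] by (auto simp: mult.commute)
    then show "0 < u" by (auto simp: zero_less_mult_iff)
    have "w u = - (w z + w z)" "u \<noteq> 0" using z u v by (auto simp: valuation_mult valuation_inverse)
    then show "u \<in> valuation_ideal w \<longleftrightarrow> z \<notin> ?O"
      using z by (auto simp: valuation_ring_def valuation_ideal_def)
  qed
  have small: "x + u \<in> S" if u: "u \<in> valuation_ideal w" and x: "x \<in> S" for x u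
  proof (cases "x \<in> ?O")
    case True
    have "u \<in> ?O" "res u = 0"
      using u res valuation_ideal_in_ring[OF u] by (auto simp: residue_map_def)
    then show ?thesis
      using x True S_in[of x] S_in[of "x + u"] v
      by (simp add: residue_map_add[OF res] valuation_ring_add)
  next
    case False
    have "u \<in> ?O" using valuation_ideal_in_ring[OF u] .
    then have out: "x + u \<notin> ?O"
      using False valuation_ring_add[OF v, of "x + u" "- u"] valuation_ring_uminus[OF v] by auto
    have "\<bar>u\<bar> < \<bar>x\<bar>" using valuation_ring_convex[OF h \<open>u \<in> ?O\<close>] False by (meson not_less)
    then show ?thesis using S_out[OF False] S_out[OF out] x by (auto simp: abs_if split: if_splits)
  qed
  have big: "\<exists>x\<in>S. x + u \<notin> S" if u: "u \<notin> valuation_ideal w" "0 < u" for u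
  proof (cases "u \<in> ?O")
    case True
    have "res u \<noteq> 0" using u True res by (simp add: residue_map_def)
    then have "0 < res u"
      using residue_map_mono[OF res zero_one_in_valuation_ring(1) True] u
      by (simp add: residue_map_zero[OF res])
    then have "0 < c (res u)" using strict_monoD[OF c(2)] c0 by metis
    then obtain k where k: "r - c (res u) < c k" "c k < r"
      using limit_point_two_sided(1)[OF c(1) lim] by blast
    obtain x where x: "x \<in> ?O" "res x = k" using residue_map_lift[OF res] .
    have "x \<in> S" using S_in[OF x(1)] x k by simp
    moreover have "x + u \<notin> S"
      using S_in[of "x + u"] x True k v
      by (simp add: residue_map_add[OF res] valuation_ring_add c(1) algebra_simps)
    ultimately show ?thesis by blast
  next
    case False
    obtain k where k: "c k < r" using limit_point_two_sided(1)[OF c(1) lim zero_less_one] by blast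
    obtain x where x: "x \<in> ?O" "res x = k" using residue_map_lift[OF res] .
    have "x \<in> S" using S_in[OF x(1)] x k by simp
    moreover have out: "x + u \<notin> ?O"
      using False valuation_ring_add[OF v, of "x + u" "- x"] valuation_ring_uminus[OF v] x by auto
    moreover have "\<bar>x\<bar> < \<bar>u\<bar>" using valuation_ring_convex[OF h x(1)] False by (meson not_less)
    ultimately show ?thesis using S_out[OF out] u(2) by (intro bexI[of _ x]) auto
  qed
  show ?thesis
  proof (cases "z = 0")
    case False
    then have inv: "inverse (z * z) * (z * z) = 1" by (intro left_inverse) simp
    show ?thesis
    proof
      assume "z \<in> ?O"
      then show "\<forall>u. u * (z * z) = 1 \<longrightarrow> (\<exists>x\<in>S. x + u \<notin> S)" using sq pos big by blast
    next
      assume "\<forall>u. u * (z * z) = 1 \<longrightarrow> (\<exists>x\<in>S. x + u \<notin> S)"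
      then show "z \<in> ?O" using sq[OF inv] small inv by blast
    qed
  qed (simp add: zero_one_in_valuation_ring)
qed

primrec Horner :: "nat list \<Rightarrow> or_term \<Rightarrow> or_term" where
  "Horner [] s = Zero"
| "Horner (v # vs) s = Add (Var v) (Mult s (Horner vs s))"

lemma term_value_Horner [simp]:
  "term_value e (Horner vs s) = poly (Poly (map e vs)) (term_value e s)"
  by (induction vs) auto

lemma term_vars_Horner: "term_vars (Horner vs s) \<subseteq> set vs \<union> term_vars s"
  by (induction vs) auto

text \<open>The variables \<open>1\<close> and \<open>2\<close> stand for the end points \<open>A\<close> and \<open>B\<close> of \<open>lifted_cut\<close>, and \<open>vs\<close> for the
  coefficients of its polynomial, constant term first.\<close>

definition Below :: "nat list \<Rightarrow> or_term \<Rightarrow> or_formula" where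
  "Below vs s = Neg (Conj (Neg (Less s (Var 1)))
     (Neg (Conj (Neg (Less (Var 2) s)) (Less (Horner vs s) Zero))))"

lemma satisfies_Below [simp]:
  "satisfies e (Below vs s) \<longleftrightarrow>
     (let x = term_value e s in x < e 1 \<or> x \<le> e 2 \<and> poly (Poly (map e vs)) x < 0)"
  by (auto simp: Below_def Let_def not_less)

lemma free_vars_Below: "free_vars (Below vs s) \<subseteq> {1, 2} \<union> set vs \<union> term_vars s"
  using term_vars_Horner[of vs s] by (auto simp: Below_def)

lemma definable_residue_field_limit_point:
  fixes w :: "'a::linordered_field \<Rightarrow> 'g::linordered_ab_group_add"
    and res :: "'a \<Rightarrow> 'k::linordered_field" and c :: "'k \<Rightarrow> 'r::linordered_field"
  assumes h: "henselian w" and res: "residue_map w res" and c: "real_closure c"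
    and lim: "limit_point (range c) r" and r: "r \<notin> range c"
  shows "definable (valuation_ring w)"
proof -
  obtain f A B where cut: "\<forall>x. (x < A \<or> x \<le> B \<and> poly f x < 0) \<longleftrightarrow>
      (if x \<in> valuation_ring w then c (res x) < r else x < 0)"
    using lifted_cut[OF h res c lim r] .
  define S where "S = {x. x < A \<or> x \<le> B \<and> poly f x < 0}"
  have ring: "z \<in> valuation_ring w \<longleftrightarrow> (\<forall>u. u * (z * z) = 1 \<longrightarrow> (\<exists>x\<in>S. x + u \<notin> S))" for z
    by (rule valuation_ring_iff_shift[OF h res _ _ lim])
      (use c cut in \<open>auto simp: real_closure_def S_def\<close>)
  \<comment> \<open>Variable \<open>0\<close> is \<open>z\<close>, then follow \<open>A\<close>, \<open>B\<close> and the coefficients; the first index beyond them and its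
    successor are free to be bound.\<close>
  define m where "m = 3 + length (coeffs f)"
  define cs where "cs = [3..<m]"
  define p where "p = (\<lambda>i. if i = 1 then A else if i = 2 then B else coeffs f ! (i - 3))"
  let ?\<phi> = "Neg (Exists m (Conj (Equal (Mult (Var m) (Mult (Var 0) (Var 0))) One)
    (Neg (Exists (Suc m) (Conj (Below cs (Var (Suc m)))
      (Neg (Below cs (Add (Var (Suc m)) (Var m)))))))))"
  have "map (p(0 := z, m := u, Suc m := x)) cs = coeffs f" for z u x
    by (rule nth_equalityI) (auto simp: cs_def m_def p_def)
  then have poly_cs: "Poly (map (p(0 := z, m := u, Suc m := x)) cs) = f" for z u x by simp
  have "m \<ge> 3" by (simp add: m_def)
  then have "satisfies (p(0 := z)) ?\<phi> \<longleftrightarrow>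
      (\<forall>u. u * (z * z) = 1 \<longrightarrow> (\<exists>x. x \<in> S \<and> x + u \<notin> S))" for z
    by (simp add: poly_cs Let_def) (simp add: p_def S_def)
  then have "valuation_ring w = {z. satisfies (p(0 := z)) ?\<phi>}" using ring by blast
  moreover have "free_vars ?\<phi> \<subseteq> {0..m}"
    using free_vars_Below[of cs "Var (Suc m)"] free_vars_Below[of cs "Add (Var (Suc m)) (Var m)"]
      \<open>m \<ge> 3\<close> by (auto simp: cs_def)
  ultimately show ?thesis unfolding definable_def definable_with_params_def by blast
qed

section \<open>Definability of the valuation ring\<close>

theorem theorem4p5:
  fixes w :: "'a::linordered_field \<Rightarrow> 'g::linordered_ab_group_add"
    and d :: "'g \<Rightarrow> 'h::linordered_ab_group_add"
    and res :: "'a \<Rightarrow> 'k::linordered_field"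
    and c :: "'k \<Rightarrow> 'r::linordered_field"
  assumes "henselian w"
    and "discretely_ordered TYPE('g) \<or>
         (divisible_hull d \<and> (\<exists>h. limit_point (range d) h \<and> h \<notin> range d)) \<or>
         (residue_map w res \<and> real_closure c \<and>
            (\<exists>r. limit_point (range c) r \<and> r \<notin> range c))"
  shows "definable (valuation_ring w) \<and>
         (discretely_ordered TYPE('g) \<or>
          (divisible_hull d \<and> (\<exists>h. limit_point (range d) h \<and> h \<notin> range d)) \<longrightarrow>
            definable_with_params 1 (valuation_ring w))"
proof -
  have "definable_with_params 1 (valuation_ring w)"
    if "discretely_ordered TYPE('g) \<or>
          (divisible_hull d \<and> (\<exists>h. limit_point (range d) h \<and> h \<notin> range d))"
    using that definable_discrete definable_value_group_limit_point assms(1) by blast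
  moreover have "definable (valuation_ring w)"
    if "residue_map w res \<and> real_closure c \<and> (\<exists>r. limit_point (range c) r \<and> r \<notin> range c)"
    using that definable_residue_field_limit_point[OF assms(1), of res c] by blast
  ultimately show ?thesis
    using assms(2) unfolding definable_def by blast
qed

end
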